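(* Let $(X,\mathrm{dist})$ be a compact metric space and let $f\colon X\to X$ be a homeomorphism. The following statements are equivalent: (1) $f$ is nonstandard expansive; (2) there is a real number $c>0$ such that for all $x,y\in X$ with $x\neq y$ the set $\{n\in\mathbb{Z}:\mathrm{dist}(f^n(x),f^n(y))>c\}$ is infinite; (3) $f$ is expansive and has no doubly-asymptotic points (i.e. there are no $x\neq y$ in $X$ which are doubly-asymptotic).
   Context: A homeomorphism $f$ of a compact metric space $(X,\mathrm{dist})$ is expansive if there is a constant $c>0$ such that for all $x\neq y$ in $X$ there is $n\in\mathbb{Z}$ with $\mathrm{dist}(f^n(x),f^n(y))>c$. Points $x,y\in X$ are doubly-asymptotic if $\mathrm{dist}(f^n(x),f^n(y))\to0$ as $n\to\pm\infty$ (both as $n\to+\infty$ and as $n\to-\infty$). Nonstandard setting: fix a nonstandard extension ${}^*$ (in Robinson's sense, via superstructures) of a superstructure over a set containing $X$ and $\mathbb{R}$, satisfying the Transfer Principle and with ${}^*\mathbb{Z}\setminus\mathbb{Z}\ne\emptyset$. Elements of ${}^*\mathbb{Z}\setminus\mathbb{Z}$ (positive or negative) are called infinite integers. For $n\in{}^*\mathbb{Z}$, ${}^*f^n$ denotes the value at $n$ of the extension of the map $\mathbb{Z}\ni n\mapsto f^n$. The homeomorphism $f$ is nonstandard expansive if there is a (standard) real constant $c>0$ such that for all $x,y\in X$ with $x\neq y$ there is an infinite integer $n\in{}^*\mathbb{Z}$ with ${}^*\mathrm{dist}({}^*f^n(x),{}^*f^n(y))>c$. *)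

theory Defs
  imports "HOL-Analysis.Analysis" "HOL-Library.Extended_Nat"
begin

text \<open>
  \<open>X\<close> is the carrier of the space and the inverse of \<open>f\<close> is taken relative to it.
\<close>

definition zpow :: "'a set \<Rightarrow> ('a \<Rightarrow> 'a) \<Rightarrow> int \<Rightarrow> 'a \<Rightarrow> 'a" where
  "zpow X f n = (if 0 \<le> n then f ^^ nat n else inv_into X f ^^ nat (- n))"

definition expansive :: "'a::metric_space set \<Rightarrow> ('a \<Rightarrow> 'a) \<Rightarrow> bool" where
  "expansive X f \<longleftrightarrow>
     (\<exists>c>0. \<forall>x\<in>X. \<forall>y\<in>X. x \<noteq> y \<longrightarrow> (\<exists>n. dist (zpow X f n x) (zpow X f n y) > c))"

definition doubly_asymptotic ::
    "'a::metric_space set \<Rightarrow> ('a \<Rightarrow> 'a) \<Rightarrow> 'a \<Rightarrow> 'a \<Rightarrow> bool" where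
  "doubly_asymptotic X f x y \<longleftrightarrow>
     ((\<lambda>n. dist (zpow X f n x) (zpow X f n y)) \<longlongrightarrow> 0) at_top \<and>
     ((\<lambda>n. dist (zpow X f n x) (zpow X f n y)) \<longlongrightarrow> 0) at_bot"

text \<open>
  Superstructures.  The superstructure over a set \<open>S\<close> of atoms is the union of the levels
  \<open>V\<^sub>0 = S\<close>, \<open>V\<^sub>n\<^sub>+\<^sub>1 = V\<^sub>n \<union> Pow V\<^sub>n\<close>.  It is described up to isomorphism by a type \<open>'u\<close> with a
  set of atoms and the function sending an object to the set of its elements.  The height \<open>h\<close>
  says which levels are present: \<open>h = \<infinity>\<close> gives the full superstructure, a finite \<open>h\<close> gives the
  superstructure cut off at \<open>V\<^sub>h\<close>.  The finite heights are included because HOL alone does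
  not provide a type large enough for the full superstructure over an infinite set.
\<close>

record 'u sstr =
  Atoms :: "'u set"
  Elts :: "'u \<Rightarrow> 'u set"

primrec level :: "'u sstr \<Rightarrow> nat \<Rightarrow> 'u set" where
  "level V 0 = Atoms V"
| "level V (Suc n) = level V n \<union> {u. u \<notin> Atoms V \<and> Elts V u \<subseteq> level V n}"

definition is_set :: "'u sstr \<Rightarrow> 'u \<Rightarrow> 'u set \<Rightarrow> bool" where
  "is_set V u B \<longleftrightarrow> u \<notin> Atoms V \<and> Elts V u = B"

definition superstructure :: "'u sstr \<Rightarrow> enat \<Rightarrow> bool" where
  "superstructure V h \<longleftrightarrow>
     (\<forall>a\<in>Atoms V. Elts V a = {}) \<and>
     (\<forall>u v B. is_set V u B \<longrightarrow> is_set V v B \<longrightarrow> u = v) \<and>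
     (\<forall>n. enat n < h \<longrightarrow> (\<forall>B\<subseteq>level V n. \<exists>u. is_set V u B)) \<and>
     (\<forall>u. \<exists>n. enat n \<le> h \<and> u \<in> level V n)"

definition sset :: "'u sstr \<Rightarrow> 'u set \<Rightarrow> 'u" where
  "sset V B = (THE u. is_set V u B)"

text \<open>
  Kuratowski pairs.  They are given by a relation because at a finite height the pair of two
  objects near the top level does not exist; the total function \<open>spair\<close> is meaningful only
  where the pair exists, and \<open>app\<close> is based on the relation for this reason.
\<close>

definition is_pair :: "'u sstr \<Rightarrow> 'u \<Rightarrow> 'u \<Rightarrow> 'u \<Rightarrow> bool" where
  "is_pair V p a b \<longleftrightarrow> (\<exists>q r. is_set V q {a} \<and> is_set V r {a, b} \<and> is_set V p {q, r})"

definition spair :: "'u sstr \<Rightarrow> 'u \<Rightarrow> 'u \<Rightarrow> 'u" where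
  "spair V a b = (THE p. is_pair V p a b)"

text \<open>
  \<open>sgraph V I a b\<close> is the function \<open>a i \<mapsto> b i\<close> (\<open>i \<in> I\<close>) as a set of pairs in \<open>V\<close>, and
  \<open>app V F a\<close> is the value at \<open>a\<close> of a function \<open>F\<close> belonging to \<open>V\<close>.
\<close>

definition sgraph :: "'u sstr \<Rightarrow> 'i set \<Rightarrow> ('i \<Rightarrow> 'u) \<Rightarrow> ('i \<Rightarrow> 'u) \<Rightarrow> 'u" where
  "sgraph V I a b = sset V ((\<lambda>i. spair V (a i) (b i)) ` I)"

definition app :: "'u sstr \<Rightarrow> 'u \<Rightarrow> 'u \<Rightarrow> 'u" where
  "app V F a = (THE b. \<exists>p\<in>Elts V F. is_pair V p a b)"

text \<open>
  Bounded formulas of the language of set theory.  Constants naming objects of the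
  superstructure are replaced by free variables together with an assignment.  In
  \<open>BEx i j p\<close>, read ``there is \<open>v\<^sub>i \<in> v\<^sub>j\<close> with \<open>p\<close>'', the bound \<open>v\<^sub>j\<close> is evaluated outside the
  scope of the quantifier.
\<close>

datatype bfm = Mem nat nat | Eq nat nat | Neg bfm | Conj bfm bfm | BEx nat nat bfm

primrec sat :: "'u sstr \<Rightarrow> bfm \<Rightarrow> (nat \<Rightarrow> 'u) \<Rightarrow> bool" where
  "sat V (Mem i j) s \<longleftrightarrow> s i \<in> Elts V (s j)"
| "sat V (Eq i j) s \<longleftrightarrow> s i = s j"
| "sat V (Neg p) s \<longleftrightarrow> \<not> sat V p s"
| "sat V (Conj p q) s \<longleftrightarrow> sat V p s \<and> sat V q s"
| "sat V (BEx i j p) s \<longleftrightarrow> (\<exists>u\<in>Elts V (s j). sat V p (s(i := u)))"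

text \<open>
  A map \<open>star\<close> from the superstructure over \<open>S\<close> to the superstructure over \<open>*S\<close> that satisfies
  the Transfer Principle.  An atom \<open>s\<close> is not literally equal to \<open>star s\<close>: the two
  superstructures live on different types, and \<open>star\<close> (injective by transfer) takes the place
  of the usual identification \<open>*s = s\<close>.
\<close>

definition transfer_principle :: "'u sstr \<Rightarrow> 'w sstr \<Rightarrow> ('u \<Rightarrow> 'w) \<Rightarrow> bool" where
  "transfer_principle V W star \<longleftrightarrow> (\<forall>p s. sat V p s \<longleftrightarrow> sat W p (star \<circ> s))"

definition extension_of_superstructure ::
    "'u sstr \<Rightarrow> 'w sstr \<Rightarrow> enat \<Rightarrow> ('u \<Rightarrow> 'w) \<Rightarrow> bool" where
  "extension_of_superstructure V W h star \<longleftrightarrow>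
     superstructure V h \<and> superstructure W h \<and>
     Elts W (star (sset V (Atoms V))) = Atoms W \<and>
     transfer_principle V W star"

text \<open>
  The space \<open>X\<close> and the reals are placed among the atoms by \<open>iX\<close> and \<open>iR\<close>; their images may
  overlap.  The objects below are \<open>\<int>\<close>, the order of \<open>\<real>\<close>, the metric of \<open>X\<close> and the
  map \<open>n \<mapsto> f\<^sup>n\<close>, whose values are themselves functions in the superstructure.  The last one
  appears first at level 6.
\<close>

definition sInt :: "'u sstr \<Rightarrow> (real \<Rightarrow> 'u) \<Rightarrow> 'u" where
  "sInt V iR = sset V (iR ` \<int>)"

definition sLess :: "'u sstr \<Rightarrow> (real \<Rightarrow> 'u) \<Rightarrow> 'u" where
  "sLess V iR = sset V {spair V (iR a) (iR b) |a b. a < b}"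

definition sDist ::
    "'u sstr \<Rightarrow> ('a::metric_space \<Rightarrow> 'u) \<Rightarrow> (real \<Rightarrow> 'u) \<Rightarrow> 'a set \<Rightarrow> 'u" where
  "sDist V iX iR X =
     sgraph V (X \<times> X) (\<lambda>(x, y). spair V (iX x) (iX y)) (\<lambda>(x, y). iR (dist x y))"

definition sIter ::
    "'u sstr \<Rightarrow> ('a \<Rightarrow> 'u) \<Rightarrow> (real \<Rightarrow> 'u) \<Rightarrow> 'a set \<Rightarrow> ('a \<Rightarrow> 'a) \<Rightarrow> 'u" where
  "sIter V iX iR X f =
     sgraph V UNIV (\<lambda>n. iR (of_int n)) (\<lambda>n. sgraph V X iX (\<lambda>x. iX (zpow X f n x)))"

definition infinite_integers ::
    "'u sstr \<Rightarrow> 'w sstr \<Rightarrow> ('u \<Rightarrow> 'w) \<Rightarrow> (real \<Rightarrow> 'u) \<Rightarrow> 'w set" where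
  "infinite_integers V W star iR =
     Elts W (star (sInt V iR)) - star ` Elts V (sInt V iR)"

definition nonstandard_extension ::
    "'u sstr \<Rightarrow> 'w sstr \<Rightarrow> enat \<Rightarrow> ('u \<Rightarrow> 'w) \<Rightarrow> ('a \<Rightarrow> 'u) \<Rightarrow> (real \<Rightarrow> 'u) \<Rightarrow> 'a set \<Rightarrow> bool" where
  "nonstandard_extension V W h star iX iR X \<longleftrightarrow>
     extension_of_superstructure V W h star \<and>
     inj_on iX X \<and> iX ` X \<subseteq> Atoms V \<and>
     inj iR \<and> range iR \<subseteq> Atoms V \<and>
     infinite_integers V W star iR \<noteq> {}"

definition nonstandard_expansive ::
    "'u sstr \<Rightarrow> 'w sstr \<Rightarrow> ('u \<Rightarrow> 'w) \<Rightarrow> ('a::metric_space \<Rightarrow> 'u) \<Rightarrow> (real \<Rightarrow> 'u)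
      \<Rightarrow> 'a set \<Rightarrow> ('a \<Rightarrow> 'a) \<Rightarrow> bool" where
  "nonstandard_expansive V W star iX iR X f \<longleftrightarrow>
     (\<exists>c>0. \<forall>x\<in>X. \<forall>y\<in>X. x \<noteq> y \<longrightarrow>
       (\<exists>n\<in>infinite_integers V W star iR.
          let fn = app W (star (sIter V iX iR X f)) n;
              d = app W (star (sDist V iX iR X))
                    (spair W (app W fn (star (iX x))) (app W fn (star (iX y))))
          in spair W (star (iR c)) d \<in> Elts W (star (sLess V iR))))"

end

theory Submission
  imports Defs
begin

text \<open>
  The equivalence of (1) and (2) holds with the same constant \<open>c\<close>.  Fix \<open>x \<noteq> y\<close> and let \<open>B\<close>
  be the set of integers \<open>n\<close> with \<open>dist (f\<^sup>n x) (f\<^sup>n y) > c\<close>.  By transfer, the hyperintegers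
  \<open>n\<close> at which the extended distance exceeds \<open>c\<close> are exactly the elements of \<open>*B\<close>
  (\<open>transfer_separation\<close>), so the claim is that \<open>*B\<close> has an infinite element if and only if
  \<open>B\<close> is infinite (\<open>infinite_integer_in_star_iff\<close>).  If \<open>B\<close> is finite, then \<open>*B\<close> consists of the
  images of the elements of \<open>B\<close>, because a finite set can be listed in a bounded formula.
  If \<open>B\<close> is infinite, then there is an injection \<open>\<phi> : \<int> \<rightarrow> B\<close>.  Its extension maps a given
  infinite integer into \<open>*B\<close>, and the value is infinite: the equation \<open>\<phi> n = b\<close> with \<open>b\<close>
  standard has at most one standard solution \<open>n\<close>, and by transfer no other solution.

  For the equivalence of (2) and (3), note that on the integers the cofinite filter is the join
  of the two filters at infinity, so \<open>x\<close> and \<open>y\<close> are doubly asymptotic if and only if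
  \<open>dist (f\<^sup>n x) (f\<^sup>n y)\<close> tends to \<open>0\<close> along the cofinite filter.  In particular it then exceeds
  any \<open>c > 0\<close> only finitely often, which gives (3) from (2).  Conversely, let \<open>c\<close> be a constant
  of expansivity and suppose that the distance exceeds \<open>c\<close> only finitely often.
  If it did not tend to \<open>0\<close>, then by compactness some
  pairs \<open>(f\<^sup>k x, f\<^sup>k y)\<close>, along distinct \<open>k\<close>, would converge to a pair \<open>(p, q)\<close> with \<open>p \<noteq> q\<close>.
  Every \<open>dist (f\<^sup>m p) (f\<^sup>m q)\<close> would then be a limit of distances at most \<open>c\<close>, against
  expansivity (\<open>tendsto_0_of_finite_separation\<close>).
\<close>

section \<open>Superstructures\<close>

lemma level_mono: "m \<le> n \<Longrightarrow> level V m \<subseteq> level V n"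
  by (induction rule: dec_induct) auto

lemma is_set_unique:
  "superstructure V h \<Longrightarrow> is_set V u B \<Longrightarrow> is_set V v B \<Longrightarrow> u = v"
  unfolding superstructure_def by blast

text \<open>
  Atoms and the empty set have the same elements, namely none; a nonempty set of elements
  identifies its set.  This keeps the predicate for atoms out of the formula for pairs.
\<close>

lemma is_set_iff_Elts:
  "superstructure V h \<Longrightarrow> B \<noteq> {} \<Longrightarrow> is_set V u B \<longleftrightarrow> Elts V u = B"
  unfolding superstructure_def is_set_def by (elim conjE) auto

lemma sset_eqI: "superstructure V h \<Longrightarrow> is_set V u B \<Longrightarrow> sset V B = u"
  unfolding sset_def by (rule the_equality) (auto intro: is_set_unique)

lemma is_set_sset:
  assumes "superstructure V h" "enat n < h" "B \<subseteq> level V n"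
  shows "is_set V (sset V B) B"
proof -
  have "\<forall>n. enat n < h \<longrightarrow> (\<forall>B\<subseteq>level V n. \<exists>u. is_set V u B)"
    using assms(1) unfolding superstructure_def by (elim conjE)
  with assms(2,3) obtain u where "is_set V u B" by meson
  then show ?thesis by (simp add: sset_eqI[OF assms(1)])
qed

lemma Elts_sset:
  "superstructure V h \<Longrightarrow> enat n < h \<Longrightarrow> B \<subseteq> level V n \<Longrightarrow> Elts V (sset V B) = B"
  using is_set_sset[of V h n B] unfolding is_set_def by blast

lemma sset_in_level:
  "superstructure V h \<Longrightarrow> enat n < h \<Longrightarrow> B \<subseteq> level V n \<Longrightarrow> sset V B \<in> level V (Suc n)"
  using is_set_sset[of V h n B] unfolding is_set_def by auto

lemma is_pair_iff_Elts:
  assumes "superstructure V h"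
  shows "is_pair V p a b \<longleftrightarrow>
    (\<exists>q r. Elts V q = {a} \<and> Elts V r = {a, b} \<and> Elts V p = {q, r})"
  unfolding is_pair_def by (simp add: is_set_iff_Elts[OF assms])

lemma is_pair_unique:
  "superstructure V h \<Longrightarrow> is_pair V p a b \<Longrightarrow> is_pair V p' a b \<Longrightarrow> p = p'"
  unfolding is_pair_def by (elim exE conjE) (metis is_set_unique)

lemma is_pair_inject:
  assumes "superstructure V h" "is_pair V p a b" "is_pair V p a' b'"
  shows "a = a' \<and> b = b'"
proof -
  obtain q r where 1: "Elts V q = {a}" "Elts V r = {a, b}" "Elts V p = {q, r}"
    using assms(2) by (auto simp: is_pair_iff_Elts[OF assms(1)])
  obtain q' r' where 2: "Elts V q' = {a'}" "Elts V r' = {a', b'}" "Elts V p = {q', r'}"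
    using assms(3) by (auto simp: is_pair_iff_Elts[OF assms(1)])
  have "{{a}, {a, b}} = Elts V ` Elts V p" using 1 by auto
  also have "\<dots> = {{a'}, {a', b'}}" using 2 by auto
  finally show ?thesis by (auto simp: doubleton_eq_iff)
qed

lemma spair_eqI: "superstructure V h \<Longrightarrow> is_pair V p a b \<Longrightarrow> spair V a b = p"
  unfolding spair_def by (rule the_equality) (auto intro: is_pair_unique)

lemma spair_level:
  assumes V: "superstructure V h" and h: "enat (Suc n) < h"
    and ab: "a \<in> level V n" "b \<in> level V n"
  shows "is_pair V (spair V a b) a b" and "spair V a b \<in> level V (n + 2)"
proof -
  define q r where "q = sset V {a}" and "r = sset V {a, b}"
  have n: "enat n < h"
    using h by (cases h) simp_all
  have qr: "{q, r} \<subseteq> level V (Suc n)"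
    using sset_in_level[OF V n, of "{a}"] sset_in_level[OF V n, of "{a, b}"] ab
    unfolding q_def r_def by simp
  have "is_set V q {a}" "is_set V r {a, b}" "is_set V (sset V {q, r}) {q, r}"
    using is_set_sset[OF V n, of "{a}"] is_set_sset[OF V n, of "{a, b}"] is_set_sset[OF V h qr] ab
    unfolding q_def r_def by simp_all
  then have *: "is_pair V (sset V {q, r}) a b" unfolding is_pair_def by blast
  then have "spair V a b = sset V {q, r}" by (rule spair_eqI[OF V])
  then show "is_pair V (spair V a b) a b" "spair V a b \<in> level V (n + 2)"
    using * sset_in_level[OF V h qr] by simp_all
qed

text \<open>
  The description operator in \<open>app\<close> cannot be transferred directly.  This relation says that
  \<open>app V F a\<close> is well defined and equal to \<open>b\<close>, and it is expressible by a bounded formula.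
\<close>

definition is_app :: "'u sstr \<Rightarrow> 'u \<Rightarrow> 'u \<Rightarrow> 'u \<Rightarrow> bool" where
  "is_app V F a b \<longleftrightarrow> (\<exists>p\<in>Elts V F. is_pair V p a b) \<and>
     (\<forall>p\<in>Elts V F. \<forall>b'. is_pair V p a b' \<longrightarrow> b' = b)"

lemma app_eqI: "is_app V F a b \<Longrightarrow> app V F a = b"
  unfolding is_app_def app_def by blast

text \<open>
  A Kuratowski pair lies two levels above its components and a graph one more, so the height
  must exceed \<open>n + 2\<close> for the graph of a map between objects of level \<open>n\<close> to exist.
\<close>

lemma sgraph_level:
  assumes V: "superstructure V h" and h: "enat (n + 2) < h"
    and a: "\<And>i. i \<in> I \<Longrightarrow> a i \<in> level V n" and b: "\<And>i. i \<in> I \<Longrightarrow> b i \<in> level V n"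
  shows "Elts V (sgraph V I a b) = (\<lambda>i. spair V (a i) (b i)) ` I"
    and "sgraph V I a b \<in> level V (n + 3)"
    and "\<lbrakk>inj_on a I; i \<in> I\<rbrakk> \<Longrightarrow> is_app V (sgraph V I a b) (a i) (b i)"
proof -
  have h1: "enat (Suc n) < h"
    using h by (cases h) simp_all
  note pair = spair_level[OF V h1 a b]
  have sub: "(\<lambda>i. spair V (a i) (b i)) ` I \<subseteq> level V (n + 2)"
    using pair(2) by blast
  show elts: "Elts V (sgraph V I a b) = (\<lambda>i. spair V (a i) (b i)) ` I"
    unfolding sgraph_def by (rule Elts_sset[OF V h sub])
  show "sgraph V I a b \<in> level V (n + 3)"
    using sset_in_level[OF V h sub] by (simp add: sgraph_def numeral_eq_Suc)
  show "is_app V (sgraph V I a b) (a i) (b i)" if inj: "inj_on a I" and i: "i \<in> I"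
    unfolding is_app_def elts
  proof (intro conjI ballI allI impI)
    show "\<exists>p\<in>(\<lambda>i. spair V (a i) (b i)) ` I. is_pair V p (a i) (b i)"
      using pair(1)[OF i i] i by blast
  next
    fix p b' assume "p \<in> (\<lambda>i. spair V (a i) (b i)) ` I" and p: "is_pair V p (a i) b'"
    then obtain j where j: "j \<in> I" "p = spair V (a j) (b j)" by blast
    then have "a i = a j \<and> b' = b j"
      using is_pair_inject[OF V p] pair(1)[OF j(1) j(1)] by blast
    then show "b' = b i" using inj i j(1) by (auto dest: inj_onD)
  qed
qed


section \<open>Bounded formulas and transfer\<close>

definition Imp :: "bfm \<Rightarrow> bfm \<Rightarrow> bfm" where
  "Imp p q = Neg (Conj p (Neg q))"

definition BAll :: "nat \<Rightarrow> nat \<Rightarrow> bfm \<Rightarrow> bfm" where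
  "BAll i j p = Neg (BEx i j (Neg p))"

lemma sat_Imp [simp]: "sat V (Imp p q) s \<longleftrightarrow> (sat V p s \<longrightarrow> sat V q s)"
  by (simp add: Imp_def)

definition Iff :: "bfm \<Rightarrow> bfm \<Rightarrow> bfm" where
  "Iff p q = Conj (Imp p q) (Imp q p)"

lemma sat_Iff [simp]: "sat V (Iff p q) s \<longleftrightarrow> (sat V p s \<longleftrightarrow> sat V q s)"
  by (auto simp: Iff_def)

lemma sat_BAll [simp]: "sat V (BAll i j p) s \<longleftrightarrow> (\<forall>u\<in>Elts V (s j). sat V p (s(i := u)))"
  by (simp add: BAll_def)

text \<open>
  The bound variables \<open>q\<close>, \<open>r\<close>, \<open>z\<close> are larger than \<open>p\<close>, \<open>a\<close> and \<open>b\<close>, so that no argument is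
  captured.
\<close>

definition pair_fm :: "nat \<Rightarrow> nat \<Rightarrow> nat \<Rightarrow> bfm" where
  "pair_fm p a b =
     (let q = Suc (p + a + b); r = Suc q; z = Suc r in
      BEx q p (BEx r p
        (Conj (Conj (Mem a q) (BAll z q (Eq z a)))
        (Conj (Conj (Mem a r) (Conj (Mem b r) (BAll z r (Imp (Neg (Eq z a)) (Eq z b)))))
              (BAll z p (Imp (Neg (Eq z q)) (Eq z r)))))))"

lemma sat_pair_fm:
  assumes "superstructure V h"
  shows "sat V (pair_fm p a b) s \<longleftrightarrow> is_pair V (s p) (s a) (s b)"
proof -
  have "sat V (pair_fm p a b) s \<longleftrightarrow> (\<exists>q\<in>Elts V (s p). \<exists>r\<in>Elts V (s p).
     (s a \<in> Elts V q \<and> (\<forall>z\<in>Elts V q. z = s a)) \<and>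
     (s a \<in> Elts V r \<and> s b \<in> Elts V r \<and> (\<forall>z\<in>Elts V r. z \<noteq> s a \<longrightarrow> z = s b)) \<and>
     (\<forall>z\<in>Elts V (s p). z \<noteq> q \<longrightarrow> z = r))"
    by (simp add: pair_fm_def Let_def)
  also have "\<dots> \<longleftrightarrow>
     (\<exists>q r. Elts V q = {s a} \<and> Elts V r = {s a, s b} \<and> Elts V (s p) = {q, r})"
    by blast
  finally show ?thesis by (simp add: is_pair_iff_Elts[OF assms])
qed

text \<open>
  In \<open>is_app\<close> the competing value \<open>b'\<close> ranges over the whole universe.  A second component of
  a Kuratowski pair \<open>p\<close> is an element of an element of \<open>p\<close>, which turns this into two bounded
  quantifiers.
\<close>

definition app_fm :: "nat \<Rightarrow> nat \<Rightarrow> nat \<Rightarrow> bfm" where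
  "app_fm F a b =
     (let p = Suc (F + a + b); r = Suc p; b' = Suc r in
      Conj (BEx p F (pair_fm p a b))
           (BAll p F (BAll r p (BAll b' r (Imp (pair_fm p a b') (Eq b' b))))))"

lemma sat_app_fm:
  assumes "superstructure V h"
  shows "sat V (app_fm F a b) s \<longleftrightarrow> is_app V (s F) (s a) (s b)"
proof -
  have "sat V (app_fm F a b) s \<longleftrightarrow> (\<exists>p\<in>Elts V (s F). is_pair V p (s a) (s b)) \<and>
     (\<forall>p\<in>Elts V (s F). \<forall>r\<in>Elts V p. \<forall>b'\<in>Elts V r. is_pair V p (s a) b' \<longrightarrow> b' = s b)"
    by (simp add: app_fm_def Let_def sat_pair_fm[OF assms])
  moreover have "\<exists>r\<in>Elts V p. b' \<in> Elts V r" if "is_pair V p a' b'" for p a' b'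
    using that by (auto simp: is_pair_iff_Elts[OF assms])
  ultimately show ?thesis unfolding is_app_def by blast
qed

text \<open>
  Parameters are listed in \<open>xs\<close>; the formulas below mention only indices within the list and
  variables that they bind themselves, so the values of \<open>(!)\<close> beyond its end do not matter.
\<close>

lemma transferD:
  "transfer_principle V W star \<Longrightarrow> sat V p ((!) xs) \<Longrightarrow> sat W p (star \<circ> (!) xs)"
  unfolding transfer_principle_def by blast

lemma transfer_Mem:
  "transfer_principle V W star \<Longrightarrow> star u \<in> Elts W (star v) \<longleftrightarrow> u \<in> Elts V v"
  unfolding transfer_principle_def
  by (drule spec[of _ "Mem 0 1"], drule spec[of _ "(!) [u, v]"]) simp

lemma transfer_subset:
  assumes "transfer_principle V W star" "Elts V A \<subseteq> Elts V B"
  shows "Elts W (star A) \<subseteq> Elts W (star B)"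
  using transferD[OF assms(1), of "BAll 2 0 (Mem 2 1)" "[A, B]"] assms(2) by auto

text \<open>
  The elements are peeled off one at a time, which replaces a disjunction of variable length by
  the single formula \<open>\<forall>u \<in> {a} \<union> B. u = a \<or> u \<in> B\<close>.
\<close>

lemma transfer_finite:
  assumes V: "superstructure V h" and h: "enat n < h"
    and T: "transfer_principle V W star"
    and "finite B" "B \<subseteq> level V n"
  shows "Elts W (star (sset V B)) \<subseteq> star ` B"
  using assms(4,5)
proof (induction B)
  case empty
  show ?case
    using transferD[OF T, of "BAll 1 0 (Neg (Eq 1 1))" "[sset V {}]"] Elts_sset[OF V h empty]
    by auto
next
  case (insert a B)
  have B: "Elts V (sset V (insert a B)) = insert a B" "Elts V (sset V B) = B"
    using Elts_sset[OF V h] insert.prems by auto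
  have "\<forall>u\<in>Elts W (star (sset V (insert a B))). u \<noteq> star a \<longrightarrow> u \<in> Elts W (star (sset V B))"
    using transferD[OF T, of "BAll 3 0 (Imp (Neg (Eq 3 1)) (Mem 3 2))"
        "[sset V (insert a B), a, sset V B]"] B
    by auto
  then show ?case using insert by blast
qed

text \<open>
  Nonstandard elements are carried along injections: the extension of \<open>\<phi>\<close> sends \<open>N\<close> to some
  \<open>M\<close> in the extension of \<open>B\<close>.  If \<open>M\<close> were the image of a standard \<open>v\<close>, then \<open>N\<close> would solve
  \<open>\<phi> N = v\<close>, whose only solution, by transfer of injectivity at \<open>v\<close>, is standard.
  The argument treats positive and negative infinite integers alike.
\<close>

lemma transfer_nonstandard_element:
  assumes V: "superstructure V h" and W: "superstructure W h" and h: "enat (n + 2) < h"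
    and T: "transfer_principle V W star"
    and A: "Elts V A \<subseteq> level V n" and B: "Elts V B \<subseteq> level V n"
    and inj: "inj_on \<phi> (Elts V A)" and \<phi>: "\<phi> ` Elts V A \<subseteq> Elts V B"
    and N: "N \<in> Elts W (star A)" "N \<notin> star ` Elts V A"
  shows "\<exists>M\<in>Elts W (star B). M \<notin> star ` Elts V B"
proof -
  define G where "G = sgraph V (Elts V A) id \<phi>"
  have app: "is_app V G u (\<phi> u)" if "u \<in> Elts V A" for u
    using sgraph_level(3)[OF V h, of "Elts V A" id \<phi> u] A B \<phi> that
    unfolding G_def by (simp add: subset_iff image_subset_iff)
  have "\<forall>u\<in>Elts V A. \<exists>v\<in>Elts V B. is_app V G u v"
    using app \<phi> by blast
  then have "\<forall>u\<in>Elts W (star A). \<exists>v\<in>Elts W (star B). is_app W (star G) u v"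
    using transferD[OF T, of "BAll 3 0 (BEx 4 1 (app_fm 2 3 4))" "[A, B, G]"]
    by (simp add: sat_app_fm[OF V] sat_app_fm[OF W])
  then obtain M where M: "M \<in> Elts W (star B)" "is_app W (star G) N M"
    using N(1) by blast
  have "M \<noteq> star v" if v: "v \<in> Elts V B" for v
  proof
    assume Mv: "M = star v"
    \<comment> \<open>If \<open>v\<close> has no preimage, the value of \<open>w\<close> is arbitrary and the implication below is vacuous.\<close>
    define w where "w = inv_into (Elts V A) \<phi> v"
    have "u = w" "w \<in> Elts V A" if "u \<in> Elts V A" "is_app V G u v" for u
    proof -
      have "v = \<phi> u" using app_eqI[OF that(2)] app_eqI[OF app[OF that(1)]] by simp
      then show "u = w" "w \<in> Elts V A" using inj that(1) by (simp_all add: w_def)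
    qed
    then have "\<forall>u\<in>Elts W (star A). is_app W (star G) u (star v) \<longrightarrow>
        u = star w \<and> star w \<in> Elts W (star A)"
      using transferD[OF T, of "BAll 4 0 (Imp (app_fm 1 4 2) (Conj (Eq 4 3) (Mem 3 0)))"
          "[A, G, v, w]"]
      by (simp add: sat_app_fm[OF V] sat_app_fm[OF W])
    then have "N = star w" "star w \<in> Elts W (star A)"
      using N(1) M(2) Mv by auto
    then show False using N(2) transfer_Mem[OF T] by blast
  qed
  then show ?thesis using M(1) by blast
qed


section \<open>Integer powers of a homeomorphism\<close>

context
  fixes X :: "'a::metric_space set" and f g :: "'a \<Rightarrow> 'a"
  assumes hom: "homeomorphism X X f g"
begin

lemma inv_into_eq: "x \<in> X \<Longrightarrow> inv_into X f x = g x"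
  using hom unfolding homeomorphism_def
  by (metis (no_types, lifting) f_inv_into_f image_eqI inv_into_into)

lemma zpow_in: "x \<in> X \<Longrightarrow> zpow X f n x \<in> X"
proof -
  have "f z \<in> X" "inv_into X f z \<in> X" if "z \<in> X" for z
    using that hom inv_into_eq by (auto simp: homeomorphism_def)
  then have "(f ^^ k) x \<in> X" "(inv_into X f ^^ k) x \<in> X" if "x \<in> X" for k
    using that by (induction k) auto
  then show "x \<in> X \<Longrightarrow> zpow X f n x \<in> X"
    by (simp add: zpow_def)
qed

lemma zpow_plus_1:
  assumes x: "x \<in> X"
  shows "zpow X f (n + 1) x = f (zpow X f n x)"
proof (cases "0 \<le> n")
  case True
  then show ?thesis by (simp add: zpow_def nat_add_distrib)
next
  case False
  then have "nat (- n) = Suc (nat (- (n + 1)))" by simp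
  then have "zpow X f n x = inv_into X f (zpow X f (n + 1) x)"
    using False by (auto simp: zpow_def)
  then show ?thesis
    using zpow_in[OF x] inv_into_eq hom unfolding homeomorphism_def by simp
qed

lemma zpow_minus_1:
  assumes x: "x \<in> X"
  shows "zpow X f (n - 1) x = g (zpow X f n x)"
  using zpow_plus_1[OF x, of "n - 1"] zpow_in[OF x] hom
  unfolding homeomorphism_def by simp

lemma zpow_add:
  assumes x: "x \<in> X"
  shows "zpow X f (m + n) x = zpow X f m (zpow X f n x)"
proof (induction m rule: int_induct[where k = 0])
  case base
  show ?case by (simp add: zpow_def)
next
  case (step1 i)
  then show ?case
    using zpow_plus_1[OF x, of "i + n"] zpow_plus_1[OF zpow_in[OF x], of i n]
    by (simp add: algebra_simps)
next
  case (step2 i)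
  then show ?case
    using zpow_minus_1[OF x, of "i + n"] zpow_minus_1[OF zpow_in[OF x], of i n]
    by (simp add: algebra_simps)
qed

lemma continuous_on_zpow: "continuous_on X (zpow X f n)"
proof (induction n rule: int_induct[where k = 0])
  case base
  show ?case by (simp add: zpow_def continuous_on_id)
next
  case (step1 i)
  have "continuous_on X f" using hom unfolding homeomorphism_def by blast
  then have "continuous_on X (\<lambda>x. f (zpow X f i x))"
    using step1 zpow_in by (auto intro: continuous_on_compose2)
  then show ?case by (simp add: zpow_plus_1 cong: continuous_on_cong)
next
  case (step2 i)
  have "continuous_on X g" using hom unfolding homeomorphism_def by blast
  then have "continuous_on X (\<lambda>x. g (zpow X f i x))"
    using step2 zpow_in by (auto intro: continuous_on_compose2)
  then show ?case by (simp add: zpow_minus_1 cong: continuous_on_cong)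
qed

text \<open>
  A compactness argument that treats both ends of the integers at once.  Times at which the two
  orbits are at least \<open>e\<close> apart would form an infinite set; along an injective sequence
  of such times the pairs converge to distinct \<open>p\<close> and \<open>q\<close>.  After a shift by any fixed \<open>m\<close> an
  injective sequence still leaves the finite set of times with distance above \<open>c\<close>, so the orbits
  of \<open>p\<close> and \<open>q\<close> never separate by more than \<open>c\<close>.
\<close>

lemma tendsto_0_of_finite_separation:
  assumes "compact X" and x: "x \<in> X" and y: "y \<in> X"
    and expansive: "\<And>p q. \<lbrakk>p \<in> X; q \<in> X; p \<noteq> q\<rbrakk> \<Longrightarrow>
      \<exists>n. dist (zpow X f n p) (zpow X f n q) > c"
    and fin: "finite {n. dist (zpow X f n x) (zpow X f n y) > c}"
  shows "((\<lambda>n. dist (zpow X f n x) (zpow X f n y)) \<longlongrightarrow> 0) cofinite"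
proof (rule ccontr)
  assume "\<not> ?thesis"
  then obtain e where e: "e > 0"
    and inf: "infinite {n. \<not> dist (zpow X f n x) (zpow X f n y) < e}"
    by (auto simp: tendsto_iff eventually_cofinite)
  obtain k :: "nat \<Rightarrow> int" where k: "inj k"
    and "range k \<subseteq> {n. \<not> dist (zpow X f n x) (zpow X f n y) < e}"
    using infinite_countable_subset[OF inf] by blast
  then have far: "dist (zpow X f (k i) x) (zpow X f (k i) y) \<ge> e" for i
    by (simp add: image_subset_iff not_less)
  define z where "z i = (zpow X f (k i) x, zpow X f (k i) y)" for i
  have "seq_compact (X \<times> X)" "\<forall>i. z i \<in> X \<times> X"
    using compact_Times[OF \<open>compact X\<close> \<open>compact X\<close>] zpow_in[OF x] zpow_in[OF y]
    by (auto simp: compact_eq_seq_compact_metric z_def)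
  then obtain pq r where "pq \<in> X \<times> X" and r: "strict_mono r" and lim: "(z \<circ> r) \<longlonglongrightarrow> pq"
    unfolding seq_compact_def by blast
  moreover obtain p q where "pq = (p, q)" by fastforce
  ultimately have p: "p \<in> X" "(\<lambda>i. zpow X f (k (r i)) x) \<longlonglongrightarrow> p"
    and q: "q \<in> X" "(\<lambda>i. zpow X f (k (r i)) y) \<longlonglongrightarrow> q"
    using tendsto_fst[OF lim] tendsto_snd[OF lim] by (simp_all add: z_def comp_def)
  have "dist p q \<ge> e"
    using tendsto_dist[OF p(2) q(2)] far by (intro LIMSEQ_le_const) auto
  then obtain m where m: "dist (zpow X f m p) (zpow X f m q) > c"
    using expansive[OF p(1) q(1)] e by fastforce
  have "(\<lambda>i. zpow X f m (zpow X f (k (r i)) w)) \<longlonglongrightarrow> zpow X f m l"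
    if "w \<in> X" "l \<in> X" "(\<lambda>i. zpow X f (k (r i)) w) \<longlonglongrightarrow> l" for w l
    using continuous_on_tendsto_compose[OF continuous_on_zpow that(3,2)] zpow_in[OF that(1)]
    by simp
  then have "(\<lambda>i. dist (zpow X f (m + k (r i)) x) (zpow X f (m + k (r i)) y))
      \<longlonglongrightarrow> dist (zpow X f m p) (zpow X f m q)"
    using p q x y by (intro tendsto_dist) (simp_all add: zpow_add)
  then have "\<forall>\<^sub>F i in sequentially.
      dist (zpow X f (m + k (r i)) x) (zpow X f (m + k (r i)) y) > c"
    using m by (rule order_tendstoD)
  then obtain i0 where "{i0..} \<subseteq> (\<lambda>i. m + k (r i)) -`
      {n. dist (zpow X f n x) (zpow X f n y) > c}"
    unfolding eventually_sequentially by auto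
  moreover have "inj (\<lambda>i. m + k (r i))"
    by (rule injI) (simp add: inj_eq[OF k] strict_mono_eq[OF r])
  ultimately have "finite {i0..}"
    using finite_vimageI[OF fin] finite_subset by blast
  then show False using infinite_Ici by blast
qed

end

lemma cofinite_int: "(cofinite :: int filter) = sup at_top at_bot"
proof (rule filter_eqI)
  fix P :: "int \<Rightarrow> bool"
  have "finite {n. \<not> P n} \<longleftrightarrow> (\<exists>a. \<forall>n\<ge>a. P n) \<and> (\<exists>b. \<forall>n\<le>b. P n)"
  proof
    assume "finite {n. \<not> P n}"
    then have "{n. \<not> P n} \<subseteq> {Min {n. \<not> P n}..Max {n. \<not> P n}}"
      by auto
    then obtain a b where "{n. \<not> P n} \<subseteq> {b..a}" by blast
    then have "\<forall>n\<ge>a + 1. P n" "\<forall>n\<le>b - 1. P n" by force+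
    then show "(\<exists>a. \<forall>n\<ge>a. P n) \<and> (\<exists>b. \<forall>n\<le>b. P n)" by blast
  next
    assume "(\<exists>a. \<forall>n\<ge>a. P n) \<and> (\<exists>b. \<forall>n\<le>b. P n)"
    then obtain a b where "{n. \<not> P n} \<subseteq> {b..a}"
      by (metis (mono_tags, lifting) atLeastAtMost_iff linear mem_Collect_eq subsetI)
    then show "finite {n. \<not> P n}" by (rule finite_subset) simp
  qed
  then show "eventually P cofinite \<longleftrightarrow> eventually P (sup at_top at_bot)"
    by (simp add: eventually_cofinite eventually_sup eventually_at_top_linorder
        eventually_at_bot_linorder)
qed

lemma doubly_asymptotic_iff_cofinite:
  "doubly_asymptotic X f x y \<longleftrightarrow>
     ((\<lambda>n. dist (zpow X f n x) (zpow X f n y)) \<longlongrightarrow> 0) cofinite"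
  by (simp add: doubly_asymptotic_def cofinite_int filterlim_def filtermap_sup)

lemma infinite_separation_iff_expansive:
  assumes "compact X" and hom: "homeomorphism X X f g"
  shows "(\<exists>c>0. \<forall>x\<in>X. \<forall>y\<in>X. x \<noteq> y \<longrightarrow>
            infinite {n::int. dist (zpow X f n x) (zpow X f n y) > c}) \<longleftrightarrow>
         expansive X f \<and> \<not> (\<exists>x\<in>X. \<exists>y\<in>X. x \<noteq> y \<and> doubly_asymptotic X f x y)"
    (is "?infinite \<longleftrightarrow> ?expansive \<and> ?no_asymptotic")
proof (intro iffI conjI)
  assume ?infinite
  then obtain c where c: "c > 0" and inf: "\<And>x y. \<lbrakk>x \<in> X; y \<in> X; x \<noteq> y\<rbrakk> \<Longrightarrow>
      infinite {n::int. dist (zpow X f n x) (zpow X f n y) > c}"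
    by blast
  have "\<exists>n. dist (zpow X f n x) (zpow X f n y) > c" if "x \<in> X" "y \<in> X" "x \<noteq> y" for x y
    using infinite_imp_nonempty[OF inf[OF that]] by blast
  then show ?expansive
    using c unfolding expansive_def by blast
  have "\<not> doubly_asymptotic X f x y" if "x \<in> X" "y \<in> X" "x \<noteq> y" for x y
  proof
    assume "doubly_asymptotic X f x y"
    then have "finite {n. \<not> dist (zpow X f n x) (zpow X f n y) < c}"
      unfolding doubly_asymptotic_iff_cofinite
      by (auto dest!: order_tendstoD(2)[OF _ c] simp: eventually_cofinite)
    then have "finite {n. dist (zpow X f n x) (zpow X f n y) > c}"
      by (rule rev_finite_subset) auto
    then show False using inf[OF that] by blast
  qed
  then show ?no_asymptotic by blast
next
  assume R: "?expansive \<and> ?no_asymptotic"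
  then obtain c where "c > 0"
    and exp: "\<forall>x\<in>X. \<forall>y\<in>X. x \<noteq> y \<longrightarrow> (\<exists>n. dist (zpow X f n x) (zpow X f n y) > c)"
    unfolding expansive_def by meson
  have "infinite {n. dist (zpow X f n x) (zpow X f n y) > c}"
    if xy: "x \<in> X" "y \<in> X" "x \<noteq> y" for x y
  proof
    assume "finite {n. dist (zpow X f n x) (zpow X f n y) > c}"
    then have "doubly_asymptotic X f x y"
      unfolding doubly_asymptotic_iff_cofinite
      by (intro tendsto_0_of_finite_separation[OF hom assms(1) xy(1,2)]) (use exp in simp_all)
    with R xy show False by blast
  qed
  with \<open>c > 0\<close> show ?infinite by auto
qed


section \<open>Nonstandard expansivity\<close>

text \<open>
  The formula describes how the set \<open>B\<close> of times is computed, for every integer \<open>n\<close>.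
  Free variables: 0 the integers, 1 a set \<open>U\<close> that bounds all remaining quantifiers,
  2 the map \<open>n \<mapsto> f\<^sup>n\<close>, 3 the metric, 4 the order of the reals, 5 and 6 the points \<open>x\<close> and \<open>y\<close>,
  7 the constant \<open>c\<close>, 8 the set \<open>B\<close>.  Bound variables: 9 the integer \<open>n\<close>, 10 the map \<open>f\<^sup>n\<close>,
  11 and 12 its values at \<open>x\<close> and \<open>y\<close>, 13 the pair of these values, 14 their distance, 15 the pair
  of \<open>c\<close> and that distance.  As the existence of the two pairs is part of the formula, transfer
  supplies them in the extension.
\<close>

definition separation_fm :: bfm where
  "separation_fm =
     BAll 9 0 (BEx 10 1 (BEx 11 1 (BEx 12 1 (BEx 13 1 (BEx 14 1 (BEx 15 1
       (Conj (app_fm 2 9 10) (Conj (app_fm 10 5 11) (Conj (app_fm 10 6 12)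
       (Conj (pair_fm 13 11 12) (Conj (app_fm 3 13 14) (Conj (pair_fm 15 7 14)
       (Iff (Mem 15 4) (Mem 9 8))))))))))))))"

lemma sat_separation_fm:
  assumes "superstructure V h"
  shows "sat V separation_fm s \<longleftrightarrow>
    (\<forall>n\<in>Elts V (s 0). \<exists>g\<in>Elts V (s 1). \<exists>a\<in>Elts V (s 1). \<exists>b\<in>Elts V (s 1).
     \<exists>q\<in>Elts V (s 1). \<exists>d\<in>Elts V (s 1). \<exists>e\<in>Elts V (s 1).
       is_app V (s 2) n g \<and> is_app V g (s 5) a \<and> is_app V g (s 6) b \<and>
       is_pair V q a b \<and> is_app V (s 3) q d \<and> is_pair V e (s 7) d \<and>
       (e \<in> Elts V (s 4) \<longleftrightarrow> n \<in> Elts V (s 8)))"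
  unfolding separation_fm_def by (simp add: sat_app_fm[OF assms] sat_pair_fm[OF assms])

text \<open>
  The formula above holds in the standard superstructure with \<open>U\<close> the set of all objects of level
  5.  This bound is large enough since the map \<open>n \<mapsto> f\<^sup>n\<close>, the highest object involved, has
  level 6.  In the extension the formula provides witnesses for all intermediate values, and
  these are the values of \<open>app\<close> and \<open>spair\<close> by uniqueness.
\<close>

lemma transfer_separation:
  fixes X :: "'a::metric_space set" and c :: real
  assumes V: "superstructure V h" and W: "superstructure W h" and h: "enat 5 < h"
    and T: "transfer_principle V W star"
    and iX: "inj_on iX X" "iX ` X \<subseteq> Atoms V" and iR: "inj iR" "range iR \<subseteq> Atoms V"
    and hom: "homeomorphism X X f g"
    and x: "x \<in> X" and y: "y \<in> X"
    and n: "n \<in> Elts W (star (sInt V iR))"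
  defines "S \<equiv> (\<lambda>n. iR (of_int n)) ` {n. dist (zpow X f n x) (zpow X f n y) > c}"
    and "fn \<equiv> app W (star (sIter V iX iR X f)) n"
  shows "spair W (star (iR c)) (app W (star (sDist V iX iR X))
           (spair W (app W fn (star (iX x))) (app W fn (star (iX y)))))
           \<in> Elts W (star (sLess V iR)) \<longleftrightarrow>
         n \<in> Elts W (star (sset V S))"
proof -
  have lt: "enat k < h" if "k \<le> 5" for k
    using that h by (cases h) auto
  have up: "u \<in> level V n" if "u \<in> level V m" "m \<le> n" for u m n
    using that(1) level_mono[OF that(2)] by (rule rev_subsetD)
  have atomX: "iX z \<in> level V 0" if "z \<in> X" for z using iX(2) that by auto
  have atomR: "iR t \<in> level V 0" for t using iR(2) by auto
  define U where "U = sset V (level V 5)"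
  have U: "Elts V U = level V 5"
    unfolding U_def by (rule Elts_sset[OF V h order_refl])
  have Z: "Elts V (sInt V iR) = iR ` \<int>"
    unfolding sInt_def using atomR by (intro Elts_sset[OF V lt[of 0]]) auto
  have S: "Elts V (sset V S) = S"
    unfolding S_def using atomR by (intro Elts_sset[OF V lt[of 0]]) auto
  have pairX: "is_pair V (spair V (iX u) (iX v)) (iX u) (iX v)"
    "spair V (iX u) (iX v) \<in> level V 2" if "u \<in> X" "v \<in> X" for u v
    using spair_level[OF V lt[of 1, simplified] atomX[OF that(1)] atomX[OF that(2)]]
    by (simp_all add: numeral_2_eq_2)
  have pairR: "is_pair V (spair V (iR s) (iR t)) (iR s) (iR t)"
    "spair V (iR s) (iR t) \<in> level V 2" for s t
    using spair_level[OF V lt[of 1, simplified] atomR atomR] by (simp_all add: numeral_2_eq_2)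
  define F where "F n = sgraph V X iX (\<lambda>x. iX (zpow X f n x))" for n
  have F: "F n \<in> level V 3" "\<And>z. z \<in> X \<Longrightarrow> is_app V (F n) (iX z) (iX (zpow X f n z))" for n
    using sgraph_level(2,3)[OF V, of 0 X iX "\<lambda>x. iX (zpow X f n x)"]
      lt[of 2] atomX zpow_in[OF hom] iX(1) unfolding F_def by (auto simp: numeral_2_eq_2)
  have Iter: "is_app V (sIter V iX iR X f) (iR (of_int n)) (F n)" for n
    unfolding sIter_def F_def[symmetric]
  proof (rule sgraph_level(3)[OF V, of 3])
    show "enat (3 + 2) < h" using lt[of 5] by simp
    show "inj (\<lambda>n. iR (of_int n))" by (rule injI) (simp add: inj_eq[OF iR(1)])
  qed (use F up[OF atomR, of 3] in auto)
  have Dist: "is_app V (sDist V iX iR X) (spair V (iX u) (iX v)) (iR (dist u v))"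
    if "u \<in> X" "v \<in> X" for u v
  proof -
    have "inj_on (\<lambda>(u, v). spair V (iX u) (iX v)) (X \<times> X)"
    proof (rule inj_onI, clarsimp)
      fix u v u' v'
      assume X: "u \<in> X" "v \<in> X" "u' \<in> X" "v' \<in> X"
        and eq: "spair V (iX u) (iX v) = spair V (iX u') (iX v')"
      have "iX u = iX u' \<and> iX v = iX v'"
        using is_pair_inject[OF V pairX(1)[OF X(1,2)]] pairX(1)[OF X(3,4)] eq by simp
      then show "u = u' \<and> v = v'" using inj_onD[OF iX(1)] X by blast
    qed
    moreover have "enat (2 + 2) < h" using lt[of 4] by simp
    ultimately show ?thesis
      using sgraph_level(3)[OF V, of 2 "X \<times> X" "\<lambda>(u, v). spair V (iX u) (iX v)"
          "\<lambda>(u, v). iR (dist u v)" "(u, v)"] pairX(2) up[OF atomR, of 2] that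
      unfolding sDist_def by auto
  qed
  have Less: "spair V (iR s) (iR t) \<in> Elts V (sLess V iR) \<longleftrightarrow> s < t" for s t
  proof -
    have "Elts V (sLess V iR) = {spair V (iR a) (iR b) |a b. a < b}"
      unfolding sLess_def using pairR(2) by (intro Elts_sset[OF V lt[of 2]]) auto
    moreover have "s = a \<and> t = b" if "spair V (iR s) (iR t) = spair V (iR a) (iR b)" for a b
      using is_pair_inject[OF V pairR(1)[of s t], of "iR a" "iR b"] pairR(1)[of a b] that
      by (simp add: inj_eq[OF iR(1)])
    ultimately show ?thesis by blast
  qed
  have witness: "\<exists>g\<in>level V 5. \<exists>a\<in>level V 5. \<exists>b\<in>level V 5.
      \<exists>q\<in>level V 5. \<exists>d\<in>level V 5. \<exists>e\<in>level V 5.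
        is_app V (sIter V iX iR X f) m g \<and> is_app V g (iX x) a \<and> is_app V g (iX y) b \<and>
        is_pair V q a b \<and> is_app V (sDist V iX iR X) q d \<and> is_pair V e (iR c) d \<and>
        (e \<in> Elts V (sLess V iR) \<longleftrightarrow> m \<in> S)"
    if "m \<in> iR ` \<int>" for m
  proof -
    obtain k where m: "m = iR (of_int k)" using \<open>m \<in> iR ` \<int>\<close> by (auto elim: Ints_cases)
    define x' y' where "x' = zpow X f k x" and "y' = zpow X f k y"
    have X: "x' \<in> X" "y' \<in> X" using zpow_in[OF hom] x y by (auto simp: x'_def y'_def)
    have "m \<in> S \<longleftrightarrow> c < dist x' y'"
      unfolding m S_def x'_def y'_def by (auto simp: inj_eq[OF iR(1)])
    then have mS: "spair V (iR c) (iR (dist x' y')) \<in> Elts V (sLess V iR) \<longleftrightarrow> m \<in> S"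
      by (simp add: Less)
    have app: "is_app V (F k) (iX x) (iX x')" "is_app V (F k) (iX y) (iX y')"
      using F(2) x y by (auto simp: x'_def y'_def)
    show ?thesis
      by (intro bexI conjI) (rule Iter[of k, folded m] app pairX(1)[OF X] Dist[OF X]
          pairR(1) mS up[OF F(1)] up[OF atomX] up[OF atomR] up[OF pairX(2)[OF X]]
          up[OF pairR(2)] X | simp)+
  qed
  have "sat V separation_fm ((!) [sInt V iR, U, sIter V iX iR X f, sDist V iX iR X,
      sLess V iR, iX x, iX y, iR c, sset V S])"
    unfolding sat_separation_fm[OF V] using witness by (simp add: Z U S)
  from transferD[OF T this] n obtain g a b q d e where
    "is_app W (star (sIter V iX iR X f)) n g" "is_app W g (star (iX x)) a"
    "is_app W g (star (iX y)) b" "is_pair W q a b" "is_app W (star (sDist V iX iR X)) q d"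
    "is_pair W e (star (iR c)) d"
    "e \<in> Elts W (star (sLess V iR)) \<longleftrightarrow> n \<in> Elts W (star (sset V S))"
    unfolding sat_separation_fm[OF W] by (simp, blast)
  then show ?thesis
    unfolding fn_def by (simp add: app_eqI spair_eqI[OF W])
qed

lemma infinite_integer_in_star_iff:
  assumes V: "superstructure V h" and W: "superstructure W h" and h: "enat 2 < h"
    and T: "transfer_principle V W star"
    and iR: "inj iR" "range iR \<subseteq> Atoms V"
    and N: "infinite_integers V W star iR \<noteq> {}"
  shows "(\<exists>n\<in>infinite_integers V W star iR.
            n \<in> Elts W (star (sset V ((\<lambda>n. iR (of_int n)) ` B)))) \<longleftrightarrow> infinite B"
proof -
  define Bs where "Bs = (\<lambda>n. iR (of_int n)) ` B"
  have lt: "enat 0 < h" using h by (cases h) auto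
  have Z: "Elts V (sInt V iR) = iR ` \<int>"
    unfolding sInt_def using iR(2) by (intro Elts_sset[OF V lt]) auto
  have ZA: "iR ` \<int> \<subseteq> Atoms V" using iR(2) by blast
  have Bs: "Bs \<subseteq> Atoms V" "Bs \<subseteq> iR ` \<int>"
    using iR(2) by (auto simp: Bs_def)
  have B: "Elts V (sset V Bs) = Bs"
    using Bs(1) by (intro Elts_sset[OF V lt]) simp
  have inf: "infinite_integers V W star iR = Elts W (star (sInt V iR)) - star ` iR ` \<int>"
    by (simp add: infinite_integers_def Z)
  have "\<exists>n\<in>infinite_integers V W star iR. n \<in> Elts W (star (sset V Bs))" if infinite: "infinite B"
  proof -
    obtain \<phi> :: "nat \<Rightarrow> int" where \<phi>: "inj \<phi>" "range \<phi> \<subseteq> B"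
      using infinite_countable_subset[OF infinite] by blast
    \<comment> \<open>An injection of the integers into \<open>B\<close>, transported to the atoms; its argument encodes an
      integer, and the floor only converts the type.\<close>
    define \<psi> where "\<psi> u = iR (of_int (\<phi> (to_nat \<lfloor>inv iR u\<rfloor>)))" for u
    have "inj_on \<psi> (iR ` \<int>)"
      by (rule inj_onI)
        (auto simp: \<psi>_def inj_eq[OF \<phi>(1)] inj_eq[OF iR(1)] inv_f_f[OF iR(1)] elim!: Ints_cases)
    moreover have "\<psi> ` (iR ` \<int>) \<subseteq> Bs"
      using \<phi>(2) by (auto simp: \<psi>_def Bs_def)
    moreover obtain N where "N \<in> Elts W (star (sInt V iR))" "N \<notin> star ` iR ` \<int>"
      using N unfolding inf by blast
    ultimately have "\<exists>n\<in>Elts W (star (sset V Bs)). n \<notin> star ` Bs"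
      using transfer_nonstandard_element[OF V W _ T, of 0 "sInt V iR" "sset V Bs" \<psi> N]
        h Bs ZA unfolding Z B by (auto simp: numeral_2_eq_2)
    moreover have "n \<notin> star ` iR ` \<int>" if "n \<in> Elts W (star (sset V Bs))" "n \<notin> star ` Bs" for n
      using that transfer_Mem[OF T] B by blast
    moreover have "Elts W (star (sset V Bs)) \<subseteq> Elts W (star (sInt V iR))"
      using Bs(2) by (intro transfer_subset[OF T]) (simp add: B Z)
    ultimately show ?thesis unfolding inf by blast
  qed
  moreover have "n \<notin> Elts W (star (sset V Bs))"
    if "finite B" "n \<in> infinite_integers V W star iR" for n
    using transfer_finite[OF V lt T, of Bs] that Bs unfolding inf Bs_def by auto
  ultimately show ?thesis unfolding Bs_def by blast
qed

theorem theorem4p1: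
  fixes X :: "'a::metric_space set" and f g :: "'a \<Rightarrow> 'a"
    and V :: "'u sstr" and W :: "'w sstr" and h :: enat
    and star :: "'u \<Rightarrow> 'w" and iX :: "'a \<Rightarrow> 'u" and iR :: "real \<Rightarrow> 'u"
  assumes "compact X"
    and "homeomorphism X X f g"
    and "6 \<le> h"
    and "nonstandard_extension V W h star iX iR X"
  shows "(nonstandard_expansive V W star iX iR X f \<longleftrightarrow>
           (\<exists>c>0. \<forall>x\<in>X. \<forall>y\<in>X. x \<noteq> y \<longrightarrow>
              infinite {n::int. dist (zpow X f n x) (zpow X f n y) > c}))
       \<and> ((\<exists>c>0. \<forall>x\<in>X. \<forall>y\<in>X. x \<noteq> y \<longrightarrow>
              infinite {n::int. dist (zpow X f n x) (zpow X f n y) > c}) \<longleftrightarrow>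
           expansive X f \<and> \<not> (\<exists>x\<in>X. \<exists>y\<in>X. x \<noteq> y \<and> doubly_asymptotic X f x y))"
proof
  have V: "superstructure V h" and W: "superstructure W h" and T: "transfer_principle V W star"
    and iX: "inj_on iX X" "iX ` X \<subseteq> Atoms V" and iR: "inj iR" "range iR \<subseteq> Atoms V"
    and N: "infinite_integers V W star iR \<noteq> {}"
    using assms(4) unfolding nonstandard_extension_def extension_of_superstructure_def by blast+
  have h: "enat 2 < h" "enat 5 < h"
    using assms(3) by (cases h; simp add: numeral_eq_enat)+
  let ?sep = "\<lambda>c x y. {n. dist (zpow X f n x) (zpow X f n y) > c}"
  show "nonstandard_expansive V W star iX iR X f \<longleftrightarrow>
      (\<exists>c>0. \<forall>x\<in>X. \<forall>y\<in>X. x \<noteq> y \<longrightarrow> infinite (?sep c x y))"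
    unfolding nonstandard_expansive_def Let_def
  proof (intro ex_cong1 conj_cong ball_cong imp_cong refl)
    fix c x y assume "x \<in> X" "y \<in> X"
    note separation = transfer_separation[OF V W h(2) T iX iR assms(2) this]
    show "(\<exists>n\<in>infinite_integers V W star iR.
        spair W (star (iR c)) (app W (star (sDist V iX iR X))
          (spair W (app W (app W (star (sIter V iX iR X f)) n) (star (iX x)))
                   (app W (app W (star (sIter V iX iR X f)) n) (star (iX y)))))
        \<in> Elts W (star (sLess V iR))) \<longleftrightarrow> infinite (?sep c x y)"
      unfolding infinite_integer_in_star_iff[OF V W h(1) T iR N, symmetric]
    proof (intro bex_cong refl)
      fix n assume "n \<in> infinite_integers V W star iR"
      then have "n \<in> Elts W (star (sInt V iR))" by (simp add: infinite_integers_def)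
      from separation[OF this, of c] show "spair W (star (iR c)) (app W (star (sDist V iX iR X))
          (spair W (app W (app W (star (sIter V iX iR X f)) n) (star (iX x)))
                   (app W (app W (star (sIter V iX iR X f)) n) (star (iX y)))))
        \<in> Elts W (star (sLess V iR)) \<longleftrightarrow>
          n \<in> Elts W (star (sset V ((\<lambda>n. iR (of_int n)) ` ?sep c x y)))" .
    qed
  qed
  show "(\<exists>c>0. \<forall>x\<in>X. \<forall>y\<in>X. x \<noteq> y \<longrightarrow> infinite (?sep c x y)) \<longleftrightarrow>
      expansive X f \<and> \<not> (\<exists>x\<in>X. \<exists>y\<in>X. x \<noteq> y \<and> doubly_asymptotic X f x y)"
    by (rule infinite_separation_iff_expansive[OF assms(1,2)])
qed

end
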